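(* Let $q\ge5$ be an odd prime power. Then the incidence structure $(\mathcal{P}_1,\mathcal{C}_1)$ is a generalized partial geometry of grade $3$, namely a $\mathrm{PG}(q-3,q-3;\,q-5,q-4,q-3)$.
   Context: Points of the projective plane $\mathrm{PG}(2,q)$ over $\mathbb{F}_q$ are written in homogeneous coordinates, normalized so that the first nonzero coordinate is $1$. Let $e_1=(1,0,0)$, $e_2=(0,1,0)$, $e_3=(0,0,1)$. A conic (for $q$ odd) is the set of points $X=(x,y,z)$ of $\mathrm{PG}(2,q)$ with $XAX^T=0$, where $A$ is a symmetric $3\times3$ matrix over $\mathbb{F}_q$ with $\det A\ne0$ ($A$ and its nonzero scalar multiples represent the same conic). $\mathcal{P}_1$ is the set of points $P\notin\{e_1,e_2,e_3\}$ of $\mathrm{PG}(2,q)$ such that no three distinct points of $\{P,e_1,e_2,e_3\}$ are collinear; thus $\mathcal{P}_1=\{(1,x,y):x,y\in\mathbb{F}_q^*\}$. $\mathcal{C}_1$ is the set of all conics containing $e_1,e_2,e_3$; these are the conics with matrix $\begin{pmatrix} 0 & a & b \\ a & 0 & 1 \\ b & 1 & 0 \end{pmatrix}$, $a,b\in\mathbb{F}_q^*$. A point of $\mathcal{P}_1$ is incident with a conic of $\mathcal{C}_1$ if it lies on it (so, as a block, a conic $\mathcal{O}\in\mathcal{C}_1$ is regarded as the point set $\mathcal{O}\cap\mathcal{P}_1$). A generalized partial geometry of grade $r$, denoted $\mathrm{PG}(s,t;\alpha_1,\dots,\alpha_r)$, is an incidence structure $(\mathcal{P},\mathcal{B})$,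 with $\mathcal{P}$ a finite non-empty set of points and $\mathcal{B}$ a family of subsets of $\mathcal{P}$ (blocks), incidence being containment, such that: (i) any two distinct points are incident with at most one common block; (ii) each block is incident with exactly $s+1$ points; (iii) each point is incident with exactly $t+1$ blocks; (iv) for any point $P$ and block $B$ with $P\notin B$, there is $\alpha\in\{\alpha_1,\dots,\alpha_r\}$ such that exactly $\alpha$ points of $B$ are joined to $P$ (two points are joined if some block contains both); (v) for each $\alpha\in\{\alpha_1,\dots,\alpha_r\}$ there exist a point $P$ and a block $B$ with $P\notin B$ such that exactly $\alpha$ points of $B$ are joined to $P$. *)

theory Defs
  imports "HOL-Analysis.Analysis" "HOL-Number_Theory.Prime_Powers"
begin

section \<open>Generalized partial geometries\<close>

definition joined :: "'p set set \<Rightarrow> 'p \<Rightarrow> 'p \<Rightarrow> bool" where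
  "joined B X Y \<longleftrightarrow> (\<exists>b\<in>B. X \<in> b \<and> Y \<in> b)"

text \<open>
  \<open>generalized_partial_geometry r P B s t A\<close>: the structure with points \<open>P\<close> and blocks \<open>B\<close>
  is a $\mathrm{PG}(s,t;\alpha_1,\dots,\alpha_r)$, where \<open>A\<close> is the set of the $r$ distinct
  numbers $\alpha_i$.
\<close>

definition generalized_partial_geometry ::
    "nat \<Rightarrow> 'p set \<Rightarrow> 'p set set \<Rightarrow> nat \<Rightarrow> nat \<Rightarrow> nat set \<Rightarrow> bool" where
  "generalized_partial_geometry r P B s t A \<longleftrightarrow>
     finite A \<and> card A = r \<and>
     finite P \<and> P \<noteq> {} \<and> B \<subseteq> Pow P \<and>
     (\<forall>X\<in>P. \<forall>Y\<in>P. X \<noteq> Y \<longrightarrow>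
        (\<forall>b\<in>B. \<forall>c\<in>B. X \<in> b \<and> Y \<in> b \<and> X \<in> c \<and> Y \<in> c \<longrightarrow> b = c)) \<and>
     (\<forall>b\<in>B. card b = s + 1) \<and>
     (\<forall>X\<in>P. card {b\<in>B. X \<in> b} = t + 1) \<and>
     (\<forall>X\<in>P. \<forall>b\<in>B. X \<notin> b \<longrightarrow> (\<exists>\<alpha>\<in>A. card {Y\<in>b. joined B X Y} = \<alpha>)) \<and>
     (\<forall>\<alpha>\<in>A. \<exists>X\<in>P. \<exists>b\<in>B. X \<notin> b \<and> card {Y\<in>b. joined B X Y} = \<alpha>)"

section \<open>The projective plane and its conics\<close>

text \<open>
  Points are represented by their unique homogeneous coordinate vector whose first nonzero entry
  is 1. The order of the coordinates is spelled out, because in the index type \<open>3\<close> the numeral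
  3 equals 0 and is thus the least element.
\<close>

definition pg2 :: "('a::field ^ 3) set" where
  "pg2 = {X. X $ 1 = 1 \<or> (X $ 1 = 0 \<and> X $ 2 = 1) \<or> (X $ 1 = 0 \<and> X $ 2 = 0 \<and> X $ 3 = 1)}"

definition pg2_collinear :: "('a::field ^ 3) set \<Rightarrow> bool" where
  "pg2_collinear S \<longleftrightarrow> (\<exists>l. l \<noteq> 0 \<and> (\<forall>X\<in>S. scalar_product l X = 0))"

abbreviation e1 :: "'a::field ^ 3" where "e1 \<equiv> vector [1, 0, 0]"
abbreviation e2 :: "'a::field ^ 3" where "e2 \<equiv> vector [0, 1, 0]"
abbreviation e3 :: "'a::field ^ 3" where "e3 \<equiv> vector [0, 0, 1]"

definition conic_of :: "'a::field ^ 3 ^ 3 \<Rightarrow> ('a ^ 3) set" where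
  "conic_of M = {X \<in> pg2. scalar_product (X v* M) X = 0}"

definition conics :: "('a::field ^ 3) set set" where
  "conics = {conic_of M | M. transpose M = M \<and> det M \<noteq> 0}"

definition P1 :: "('a::field ^ 3) set" where
  "P1 = {P \<in> pg2 - {e1, e2, e3}.
          \<forall>S. S \<subseteq> {P, e1, e2, e3} \<and> card S = 3 \<longrightarrow> \<not> pg2_collinear S}"

definition C1 :: "('a::field ^ 3) set set" where
  "C1 = {C \<in> conics. {e1, e2, e3} \<subseteq> C}"

definition C1_blocks :: "('a::field ^ 3) set set" where
  "C1_blocks = (\<lambda>C. C \<inter> P1) ` C1"

end

theory Submission
  imports "HOL-Number_Theory.Residues" Defs
begin

text \<open>A conic \<open>a x + b y + c x y = 0\<close> through the base points becomes, under the Cremona map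
  \<open>x = 1/u\<close>, \<open>y = 1/v\<close>, an affine line \<open>b u + a v + c = 0\<close> that is neither parallel to an axis nor
  through the origin. So the structure is isomorphic to the points off the axes with these lines, and
  a point \<open>P\<close> is joined to every point of a block except those where one of the three forbidden lines
  through \<open>P\<close> (horizontal, vertical, through the origin) meets it. As \<open>2 \<noteq> 0\<close>, at least one of
  the three does so, and each number from one to three occurs.\<close>

section \<open>Transport of generalized partial geometries along injective maps\<close>

lemma joined_image:
  assumes "inj_on f P" "B \<subseteq> Pow P" "X \<in> P" "Y \<in> P"
  shows "joined ((`) f ` B) (f X) (f Y) \<longleftrightarrow> joined B X Y"
proof -
  have "f Z \<in> f ` b \<longleftrightarrow> Z \<in> b" if "Z \<in> P" "b \<in> B" for Z b
    using that assms(1,2) by (meson PowD inj_on_image_mem_iff subsetD)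
  then show ?thesis
    using assms(3,4) unfolding joined_def by auto
qed

text \<open>All axioms speak only of membership and cardinality, which an injective point map
  preserves. This carries the result for lines over to conics.\<close>

lemma generalized_partial_geometry_image:
  assumes inj: "inj_on f P" and geo: "generalized_partial_geometry r P B s t A"
  shows "generalized_partial_geometry r (f ` P) ((`) f ` B) s t A"
proof -
  have BP: "B \<subseteq> Pow P"
    using geo by (simp add: generalized_partial_geometry_def)
  have mem: "f X \<in> f ` b \<longleftrightarrow> X \<in> b" if "X \<in> P" "b \<in> B" for X b
    using that inj BP by (meson PowD inj_on_image_mem_iff subsetD)
  \<comment> \<open>Distinct blocks must keep distinct images, or the number of blocks through a
    point could drop.\<close>
  have injB: "inj_on ((`) f) B"
    using inj_on_image_Pow[OF inj] BP by (rule inj_on_subset)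
  have card_block: "card (f ` b) = card b" if "b \<in> B" for b
    using that inj BP by (meson PowD card_image inj_on_subset subsetD)
  have card_pencil: "card {c \<in> (`) f ` B. f X \<in> c} = card {b \<in> B. X \<in> b}" if "X \<in> P" for X
  proof -
    have "{c \<in> (`) f ` B. f X \<in> c} = (`) f ` {b \<in> B. X \<in> b}"
      using mem that by auto
    then show ?thesis
      using injB by (simp add: card_image inj_on_subset)
  qed
  have card_joined: "card {Y \<in> f ` b. joined ((`) f ` B) (f X) Y} = card {Y \<in> b. joined B X Y}"
    if "X \<in> P" "b \<in> B" for X b
  proof -
    have bP: "b \<subseteq> P"
      using that BP by auto
    then have "{Y \<in> f ` b. joined ((`) f ` B) (f X) Y} = f ` {Y \<in> b. joined B X Y}"
      using joined_image[OF inj BP \<open>X \<in> P\<close>] by auto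
    moreover have "inj_on f {Y \<in> b. joined B X Y}"
      using inj bP by (auto intro: inj_on_subset)
    ultimately show ?thesis
      by (simp add: card_image)
  qed
  have uniq: "\<forall>X\<in>P. \<forall>Y\<in>P. X \<noteq> Y \<longrightarrow>
      (\<forall>b\<in>B. \<forall>c\<in>B. X \<in> b \<and> Y \<in> b \<and> X \<in> c \<and> Y \<in> c \<longrightarrow> b = c)"
    using geo unfolding generalized_partial_geometry_def by (elim conjE)
  have attained: "\<forall>\<alpha>\<in>A. \<exists>X\<in>P. \<exists>b\<in>B. X \<notin> b \<and> card {Y \<in> b. joined B X Y} = \<alpha>"
    using geo unfolding generalized_partial_geometry_def by (elim conjE)
  show ?thesis
    unfolding generalized_partial_geometry_def ball_simps bex_simps
  proof (intro conjI ballI impI)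
    show "(`) f ` B \<subseteq> Pow (f ` P)"
      using BP by auto
    show "f ` b = f ` c"
      if "X \<in> P" "Y \<in> P" "f X \<noteq> f Y" "b \<in> B" "c \<in> B"
        "f X \<in> f ` b \<and> f Y \<in> f ` b \<and> f X \<in> f ` c \<and> f Y \<in> f ` c" for X Y b c
    proof -
      have "X \<noteq> Y"
        using that(3) by blast
      then show ?thesis
        using uniq[rule_format, of X Y b c] that by (simp add: mem)
    qed
    show "card (f ` b) = s + 1" if "b \<in> B" for b
      using geo that by (simp add: card_block generalized_partial_geometry_def)
    show "card {c \<in> (`) f ` B. f X \<in> c} = t + 1" if "X \<in> P" for X
      using geo that by (simp add: card_pencil generalized_partial_geometry_def)
    show "\<exists>\<alpha>\<in>A. card {Y \<in> f ` b. joined ((`) f ` B) (f X) Y} = \<alpha>"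
      if "X \<in> P" "b \<in> B" "f X \<notin> f ` b" for X b
      using geo that by (simp add: mem card_joined generalized_partial_geometry_def)
    show "\<exists>X\<in>P. \<exists>b\<in>B. f X \<notin> f ` b \<and> card {Y \<in> f ` b. joined ((`) f ` B) (f X) Y} = \<alpha>"
      if "\<alpha> \<in> A" for \<alpha>
    proof -
      obtain X b where "X \<in> P" "b \<in> B" "X \<notin> b" "card {Y \<in> b. joined B X Y} = \<alpha>"
        using attained \<open>\<alpha> \<in> A\<close> by blast
      then show ?thesis
        by (intro bexI[of _ X] bexI[of _ b]) (simp_all add: mem card_joined)
    qed
  qed (use geo in \<open>simp_all add: generalized_partial_geometry_def\<close>)
qed

section \<open>Affine lines restricted to the points off the axes\<close>

definition torus :: "('a::field \<times> 'a) set" where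
  "torus = (- {0}) \<times> (- {0})"

text \<open>Normalizing the constant term to 1 excludes lines through the origin and makes the
  coefficient pair unique; a pair in \<open>torus\<close> also excludes lines parallel to an
  axis.\<close>

definition line :: "'a::field \<times> 'a \<Rightarrow> ('a \<times> 'a) set" where
  "line p = {x \<in> torus. fst p * fst x + snd p * snd x = 1}"

definition cremona_point :: "'a::field \<times> 'a \<Rightarrow> 'a ^ 3" where
  "cremona_point x = vector [1, inverse (fst x), inverse (snd x)]"

lemma line_subset_torus: "line p \<subseteq> torus"
  by (auto simp: line_def)

text \<open>The incidence equation is symmetric in coefficients and coordinates. This self-duality
  turns facts about points on a line into facts about lines through a point.\<close>

lemma mem_line_commute: "p \<in> torus \<Longrightarrow> x \<in> line p \<longleftrightarrow> x \<in> torus \<and> p \<in> line x"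
  by (auto simp: line_def mult.commute)

text \<open>The parameter is the first summand of the line equation, so the second is
  \<open>1 - u\<close>; both must be nonzero.\<close>

lemma line_eq_image:
  assumes "a \<noteq> 0" "b \<noteq> 0"
  shows "line (a, b) = (\<lambda>u. (u / a, (1 - u) / b)) ` (- {0, 1})"
proof (intro equalityI subsetI)
  fix x assume "x \<in> line (a, b)"
  then have x: "fst x \<noteq> 0" "snd x \<noteq> 0" and e: "a * fst x + b * snd x = 1"
    by (auto simp: line_def torus_def)
  have "b * snd x = 1 - a * fst x"
    using e by (simp add: eq_diff_eq add.commute)
  then have "x = (a * fst x / a, (1 - a * fst x) / b)" and "1 - a * fst x \<noteq> 0"
    using assms x by (auto simp: prod_eq_iff field_simps)
  then show "x \<in> (\<lambda>u. (u / a, (1 - u) / b)) ` (- {0, 1})"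
    using x assms by (intro image_eqI[of _ _ "a * fst x"]) auto
qed (use assms in \<open>auto simp: line_def torus_def\<close>)

lemma inj_line_param: "a \<noteq> 0 \<Longrightarrow> inj_on (\<lambda>u. (u / a, (1 - u) / b :: 'a::field)) S"
  by (auto simp: inj_on_def)

lemma card_line:
  fixes p :: "'a::{field,finite} \<times> 'a"
  assumes "p \<in> torus"
  shows "card (line p) = CARD('a) - 2"
proof -
  obtain a b where p: "p = (a, b)" "a \<noteq> 0" "b \<noteq> 0"
    using assms by (auto simp: torus_def)
  have "card (line p) = card (- {0, 1 :: 'a})"
    using p by (simp add: line_eq_image card_image inj_line_param)
  then show ?thesis
    by (simp add: Compl_eq_Diff_UNIV card_Diff_subset)
qed

lemma distinct_points_on_line:
  fixes u v u' v' :: "'a::field"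
  assumes "(u, v) \<in> line p" "(u', v') \<in> line p" "(u, v) \<noteq> (u', v')" "p \<in> torus"
  shows "u \<noteq> u'" "v \<noteq> v'" "u * v' \<noteq> u' * v"
proof -
  obtain a b where p: "p = (a, b)" and ab: "a \<noteq> 0" "b \<noteq> 0"
    using assms(4) by (auto simp: torus_def)
  have 1: "a * u + b * v = 1" and 2: "a * u' + b * v' = 1"
    using assms(1,2) by (auto simp: line_def p)
  show u: "u \<noteq> u'"
    using 1 2 ab assms(3) by (metis add_left_cancel mult_left_cancel)
  show v: "v \<noteq> v'"
    using 1 2 ab u by (metis add_right_cancel mult_left_cancel)
  \<comment> \<open>This combination of the two line equations eliminates \<open>b\<close>.\<close>
  have "v' - v = v' * (a * u + b * v) - v * (a * u' + b * v')"
    using 1 2 by simp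
  also have "\<dots> = a * (u * v' - u' * v)"
    by (simp add: algebra_simps)
  finally show "u * v' \<noteq> u' * v"
    using v by auto
qed

text \<open>Cramer's rule gives the coefficients of the connecting line; the three inequalities say
  that its determinant and both coefficients are nonzero.\<close>

lemma joined_lines_iff:
  fixes u v u' v' :: "'a::field"
  assumes "(u, v) \<in> torus" "(u', v') \<in> torus" "(u, v) \<noteq> (u', v')"
  shows "joined (line ` torus) (u, v) (u', v') \<longleftrightarrow> u \<noteq> u' \<and> v \<noteq> v' \<and> u * v' \<noteq> u' * v"
proof
  assume "joined (line ` torus) (u, v) (u', v')"
  then show "u \<noteq> u' \<and> v \<noteq> v' \<and> u * v' \<noteq> u' * v"
    unfolding joined_def using distinct_points_on_line assms(3) by blast
next
  assume *: "u \<noteq> u' \<and> v \<noteq> v' \<and> u * v' \<noteq> u' * v"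
  define D where "D = u * v' - u' * v"
  have D: "D \<noteq> 0"
    using * by (simp add: D_def)
  have "(v' - v) * u + (u - u') * v = D" "(v' - v) * u' + (u - u') * v' = D"
    by (simp_all add: D_def algebra_simps)
  then have "(u, v) \<in> line ((v' - v) / D, (u - u') / D)"
    "(u', v') \<in> line ((v' - v) / D, (u - u') / D)"
    using D assms(1,2) by (simp_all add: line_def add_divide_distrib[symmetric])
  moreover have "((v' - v) / D, (u - u') / D) \<in> torus"
    using * D by (auto simp: torus_def)
  ultimately show "joined (line ` torus) (u, v) (u', v')"
    unfolding joined_def by blast
qed

text \<open>By duality, distinct \<open>p\<close> and \<open>p'\<close> are two points on
  \<open>line x\<close>, so the determinant of their coefficients is nonzero and the two equations
  have at most one common solution.\<close>

lemma line_unique: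
  fixes x y :: "'a::field \<times> 'a"
  assumes "x \<noteq> y" "x \<in> line p" "y \<in> line p" "x \<in> line p'" "y \<in> line p'" "p \<in> torus" "p' \<in> torus"
  shows "p = p'"
proof (rule ccontr)
  assume "p \<noteq> p'"
  moreover obtain a b a' b' u v u' v' where [simp]:
    "p = (a, b)" "p' = (a', b')" "x = (u, v)" "y = (u', v')"
    by (metis surj_pair)
  have "p \<in> line x" "p' \<in> line x" "p \<in> line y" "p' \<in> line y" "x \<in> torus" "y \<in> torus"
    using assms mem_line_commute line_subset_torus by blast+
  ultimately have "a * b' \<noteq> a' * b"
    using distinct_points_on_line(3)[of a b x a' b'] by simp
  have 1: "a * u + b * v = 1" "a' * u + b' * v = 1" "a * u' + b * v' = 1" "a' * u' + b' * v' = 1"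
    using assms by (auto simp: line_def)
  \<comment> \<open>Eliminating the second coordinate shows that \<open>u\<close> and
    \<open>u'\<close> solve the same linear equation.\<close>
  have "(a * b' - a' * b) * u = b' * (a * u + b * v) - b * (a' * u + b' * v)"
    by (simp add: algebra_simps)
  also have "\<dots> = b' * (a * u' + b * v') - b * (a' * u' + b' * v')"
    by (simp only: 1)
  also have "\<dots> = (a * b' - a' * b) * u'"
    by (simp add: algebra_simps)
  finally have "u = u'"
    using \<open>a * b' \<noteq> a' * b\<close> by simp
  then show False
    using distinct_points_on_line(1)[of u v p u' v'] assms by simp
qed


text \<open>By duality the lines through \<open>x\<close> are those whose coefficients lie on
  \<open>line x\<close>, so they are counted like the points of a line once \<open>line\<close> is
  known to be injective.\<close>

lemma card_pencil:
  fixes x :: "'a::{field,finite} \<times> 'a"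
  assumes "x \<in> torus" "3 < CARD('a)"
  shows "card {b \<in> line ` torus. x \<in> b} = CARD('a) - 2"
proof -
  have inj: "inj_on line (torus :: ('a \<times> 'a) set)"
  proof (rule inj_onI)
    fix p p' :: "'a \<times> 'a"
    assume pp: "p \<in> torus" "p' \<in> torus" "line p = line p'"
    \<comment> \<open>A line has at least two points because the field has more than three elements,
      and two points determine the coefficients.\<close>
    have "1 < card (line p)"
      using pp assms(2) by (simp add: card_line)
    then obtain x y where "x \<in> line p" "y \<in> line p" "x \<noteq> y"
      by (metis card_le_Suc0_iff_eq finite not_le One_nat_def)
    then show "p = p'"
      using pp line_unique by blast
  qed
  have "{b \<in> line ` torus. x \<in> b} = line ` line x"
    using assms(1) mem_line_commute line_subset_torus by blast
  moreover have "inj_on line (line x)"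
    using inj line_subset_torus by (rule inj_on_subset)
  ultimately show ?thesis
    using assms(1) by (simp add: card_image card_line)
qed

section \<open>Counting the points of a block joined to a given point\<close>

text \<open>On the line, parametrised by \<open>m \<mapsto> (m / a, (1 - m) / b)\<close>, the values \<open>0, 1\<close> correspond to the missing points on
  the axes; the other three values correspond to the points that are not joined to \<open>(u, v)\<close> because
  the connecting line is vertical, horizontal, or passes through the origin. If the last of these
  does not exist then \<open>a u + b v = 0\<close>, and the junk value \<open>0\<close> of the quotient has no effect.\<close>

lemma card_joined_line:
  fixes a b u v :: "'a::{field,finite}"
  assumes "(a, b) \<in> torus" "(u, v) \<in> torus" "(u, v) \<notin> line (a, b)"
  shows "card {Y \<in> line (a, b). joined (line ` torus) (u, v) Y} =
    CARD('a) - card {0, 1, a * u, 1 - b * v, a * u / (a * u + b * v)}"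
proof -
  let ?f = "\<lambda>m. (m / a, (1 - m) / b)"
  have nz: "a \<noteq> 0" "b \<noteq> 0" "u \<noteq> 0" "v \<noteq> 0"
    using assms by (auto simp: torus_def)
  have "joined (line ` torus) (u, v) (?f m) \<longleftrightarrow> m \<notin> {a * u, 1 - b * v, a * u / (a * u + b * v)}"
    if m: "m \<in> - {0, 1}" for m
  proof -
    have "?f m \<in> line (a, b)"
      using m nz by (simp add: line_eq_image)
    then have "?f m \<in> torus" "(u, v) \<noteq> ?f m"
      using assms line_subset_torus by (blast, metis)
    then have "joined (line ` torus) (u, v) (?f m) \<longleftrightarrow>
        u \<noteq> m / a \<and> v \<noteq> (1 - m) / b \<and> u * ((1 - m) / b) \<noteq> m / a * v"
      using assms(2) by (simp add: joined_lines_iff)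
    moreover have "u = m / a \<longleftrightarrow> m = a * u"
      using nz by (auto simp: field_simps)
    moreover have "v = (1 - m) / b \<longleftrightarrow> m = 1 - b * v"
      using nz by (auto simp: field_simps)
    moreover have "u * ((1 - m) / b) = m / a * v \<longleftrightarrow> m = a * u / (a * u + b * v)"
    proof -
      have "u * ((1 - m) / b) = m / a * v \<longleftrightarrow> a * u * (1 - m) = m * (b * v)"
        using nz by (simp add: field_simps)
      also have "\<dots> \<longleftrightarrow> m * (a * u + b * v) = a * u"
        by (auto simp: algebra_simps)
      also have "\<dots> \<longleftrightarrow> m = a * u / (a * u + b * v)"
        using nz m by (cases "a * u + b * v = 0") (auto simp: eq_divide_eq)
      finally show ?thesis .
    qed
    ultimately show ?thesis
      by simp
  qed
  then have "{Y \<in> line (a, b). joined (line ` torus) (u, v) Y} =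
      ?f ` (- {0, 1, a * u, 1 - b * v, a * u / (a * u + b * v)})"
    using nz by (auto simp: line_eq_image)
  then show ?thesis
    using nz by (simp only: card_image[OF inj_line_param[OF nz(1)]] Compl_eq_Diff_UNIV card_Diff_subset finite subset_UNIV)
qed

text \<open>Here \<open>m = a * u\<close> and \<open>n = b * v\<close>, and
  \<open>m + n \<noteq> 1\<close> says that the point is off the line. Generically the five values
  differ. Each of \<open>m = 1\<close>, \<open>n = 1\<close>, \<open>m + n = 0\<close> makes one
  value collapse to 0 or 1, the last through division by zero giving 0.\<close>

lemma card_exceptional:
  fixes m n :: "'a::field"
  assumes "m \<noteq> 0" "n \<noteq> 0" "m + n \<noteq> 1"
  shows "card {0, 1, m, 1 - n, m / (m + n)} =
    5 - of_bool (m = 1) - of_bool (n = 1) - of_bool (m + n = 0)"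
proof -
  have "m \<noteq> 1 - n"
    using assms(3) by auto
  moreover have "m / (m + n) = 0 \<longleftrightarrow> m + n = 0" "m / (m + n) \<noteq> 1"
    using assms(1,2) by (auto simp: divide_eq_eq)
  moreover have "m / (m + n) \<noteq> m"
    using assms by (auto simp: divide_eq_eq)
  moreover have "m / (m + n) = 1 - n \<longleftrightarrow> n = 1 \<and> m + n = 0"
  proof (cases "m + n = 0")
    case False
    have "m / (m + n) = 1 - n \<longleftrightarrow> m = (1 - n) * (m + n)"
      using False by (simp add: divide_eq_eq)
    also have "\<dots> \<longleftrightarrow> n * (m + n) = n"
      by (auto simp: algebra_simps)
    finally have "m / (m + n) = 1 - n \<longleftrightarrow> n * (m + n) = n" .
    \<comment> \<open>Cancelling the nonzero \<open>n\<close> would yield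
      \<open>m + n = 1\<close>.\<close>
    then show ?thesis
      using False assms by auto
  qed auto
  moreover have "1 - n = 0 \<longleftrightarrow> n = 1" "1 - n \<noteq> 1"
    using assms(2) by auto
  ultimately show ?thesis
    using assms(1) by (auto simp: card_insert_if)
qed

lemma generalized_partial_geometry_lines:
  assumes two: "(2 :: 'a::{field,finite}) \<noteq> 0" and q: "5 \<le> CARD('a)"
  shows "generalized_partial_geometry 3 (torus :: ('a \<times> 'a) set) (line ` torus)
    (CARD('a) - 3) (CARD('a) - 3) {CARD('a) - 5, CARD('a) - 4, CARD('a) - 3}"
proof -
  let ?q = "CARD('a)"
  \<comment> \<open>The three conditions say, in order, that the vertical line through the point
    meets the block's line on an axis, that the horizontal one does, and that the line through the
    origin is parallel to it.\<close>
  have count: "card {Y \<in> line (a, b). joined (line ` torus) (u, v) Y} =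
      ?q - (5 - of_bool (a * u = 1) - of_bool (b * v = 1) - of_bool (a * u + b * v = 0))"
    if "(a, b) \<in> torus" "(u, v) \<in> torus" "(u, v) \<notin> line (a, b)" for a b u v :: 'a
  proof -
    have nz: "a * u \<noteq> 0" "b * v \<noteq> 0" "a * u + b * v \<noteq> 1"
      using that by (auto simp: torus_def line_def)
    show ?thesis
      unfolding card_joined_line[OF that] card_exceptional[OF nz] ..
  qed
  have fresh: "\<exists>n. n \<notin> S" if "card S < ?q" for S :: "'a set"
    using that by (metis UNIV_eq_I less_irrefl)
  let ?attained = "\<lambda>\<alpha>. \<exists>X\<in>(torus :: ('a \<times> 'a) set). \<exists>b\<in>line ` torus.
    X \<notin> b \<and> card {Y \<in> b. joined (line ` torus) X Y} = \<alpha>"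
  \<comment> \<open>With the point fixed at \<open>(1, 1)\<close>, the products \<open>a * u\<close>
    and \<open>b * v\<close> are just the coefficients of the line, hence freely
    prescribable.\<close>
  have witness: "?attained (?q - (5 - of_bool (m = 1) - of_bool (n = 1) - of_bool (m + n = 0)))"
    if "m \<noteq> 0" "n \<noteq> 0" "m + n \<noteq> 1" for m n :: 'a
  proof -
    have "(m, n) \<in> torus" "(1, 1) \<in> (torus :: ('a \<times> 'a) set)" "(1, 1) \<notin> line (m, n)"
      using that by (auto simp: torus_def line_def)
    then show ?thesis
      using count[of m n 1 1] unfolding mult_1_right by blast
  qed
  have exactly: "\<exists>\<alpha>\<in>{?q - 5, ?q - 4, ?q - 3}. card {Y \<in> b. joined (line ` torus) X Y} = \<alpha>"
    if X: "X \<in> torus" "X \<notin> b" and b: "b \<in> line ` torus" for X :: "'a \<times> 'a" and b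
  proof -
    obtain u v a c where [simp]: "X = (u, v)" "b = line (a, c)" and "(a, c) \<in> torus"
      using b by (metis imageE surj_pair)
    then show ?thesis
      using X count[of a c u v] two
      \<comment> \<open>All three conditions together would give \<open>2 = 0\<close>, so at most
        two of them hold.\<close>
      by (cases "a * u = 1"; cases "c * v = 1"; cases "a * u + c * v = 0") simp_all
  qed
  have attained: "?attained (?q - 5)" "?attained (?q - 4)" "?attained (?q - 3)"
  proof -
    \<comment> \<open>The forbidden values are chosen so that \<open>(m, n)\<close> satisfies none
      of the three conditions, \<open>(1, n)\<close> only the first, and, later,
      \<open>(1, 1)\<close> exactly the first two. At most four values are avoided, fewer than the
      size of the field.\<close>
    have "card {0, 1, - 1 :: 'a} < ?q"
      using q by (simp add: card_insert_if)
    then obtain n :: 'a where n: "n \<notin> {0, 1, - 1}"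
      using fresh by blast
    have "card {0, 1, - n, 1 - n} < ?q"
      using q by (simp add: card_insert_if)
    then obtain m :: 'a where m: "m \<notin> {0, 1, - n, 1 - n}"
      using fresh by blast
    have "m + n \<noteq> 0" "m + n \<noteq> 1" "1 + n \<noteq> 0"
      using m n by (auto simp: add_eq_0_iff eq_diff_eq)
    then show "?attained (?q - 5)" "?attained (?q - 4)"
      using witness[of m n] witness[of 1 n] m n by simp_all
    have "(1 :: 'a) + 1 \<noteq> 1"
      by (metis add_cancel_right_right zero_neq_one)
    then show "?attained (?q - 3)"
      using witness[of 1 1] two by simp
  qed
  show ?thesis
    unfolding generalized_partial_geometry_def
  proof (intro conjI)
    \<comment> \<open>Truncated subtraction is exact here because \<open>5 \<le> ?q\<close>.\<close>
    show "card {?q - 5, ?q - 4, ?q - 3} = 3"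
      using q by (simp add: card_insert_if) linarith
    have "(1, 1) \<in> (torus :: ('a \<times> 'a) set)"
      by (simp add: torus_def)
    then show "(torus :: ('a \<times> 'a) set) \<noteq> {}"
      by blast
    show "line ` torus \<subseteq> Pow (torus :: ('a \<times> 'a) set)"
      using line_subset_torus by blast
    show "\<forall>X\<in>torus. \<forall>Y\<in>torus. X \<noteq> Y \<longrightarrow> (\<forall>b\<in>line ` torus. \<forall>c\<in>line ` torus.
        X \<in> b \<and> Y \<in> b \<and> X \<in> c \<and> Y \<in> c \<longrightarrow> b = (c :: ('a \<times> 'a) set))"
      using line_unique by blast
    show "\<forall>b\<in>line ` (torus :: ('a \<times> 'a) set). card b = ?q - 3 + 1"
      using q by (auto simp: card_line)
    show "\<forall>X\<in>(torus :: ('a \<times> 'a) set). card {b \<in> line ` torus. X \<in> b} = ?q - 3 + 1"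
      using q by (auto simp: card_pencil)
    show "\<forall>\<alpha>\<in>{?q - 5, ?q - 4, ?q - 3}. ?attained \<alpha>"
      using attained by (intro ballI) (elim insertE emptyE; hypsubst)
    show "\<forall>X\<in>torus. \<forall>b\<in>line ` torus. X \<notin> b \<longrightarrow>
        (\<exists>\<alpha>\<in>{?q - 5, ?q - 4, ?q - 3}. card {Y \<in> b. joined (line ` torus) (X :: 'a \<times> 'a) Y} = \<alpha>)"
      using exactly by blast
  qed simp_all
qed

section \<open>Coordinates for the points and conics of the projective plane\<close>

lemma vec3_eq_iff: "x = y \<longleftrightarrow> x $ 1 = y $ 1 \<and> x $ 2 = y $ 2 \<and> x $ 3 = (y :: 'a ^ 3) $ 3"
  by (simp add: vec_eq_iff forall_3)

lemma scalar_product_3: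
  "scalar_product x y = x $ 1 * y $ 1 + x $ 2 * y $ 2 + x $ 3 * (y :: 'a::field ^ 3) $ 3"
  by (simp add: scalar_product_def sum_3)

text \<open>A vanishing coordinate puts \<open>P\<close> on the line through two base points.
  Conversely, a linear form vanishing on three of the four points has all coefficients zero.\<close>

lemma P1_eq: "P1 = {P :: 'a::field ^ 3. P $ 1 = 1 \<and> P $ 2 \<noteq> 0 \<and> P $ 3 \<noteq> 0}"
proof (intro equalityI subsetI CollectI)
  fix P :: "'a ^ 3" assume "P \<in> P1"
  then have P: "P \<in> pg2" "P \<noteq> e1" "P \<noteq> e2" "P \<noteq> e3"
    and nc: "\<And>S. S \<subseteq> {P, e1, e2, e3} \<Longrightarrow> card S = 3 \<Longrightarrow> \<not> pg2_collinear S"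
    by (auto simp: P1_def)
  have ne: "(e1 :: 'a ^ 3) \<noteq> e2" "(e1 :: 'a ^ 3) \<noteq> e3" "(e2 :: 'a ^ 3) \<noteq> e3"
    by (simp_all add: vec3_eq_iff)
  have "P $ 1 \<noteq> 0"
  proof
    assume "P $ 1 = 0"
    then have "pg2_collinear {P, e2, e3}"
      unfolding pg2_collinear_def
      by (intro exI[of _ e1]) (simp add: vec3_eq_iff scalar_product_3)
    then show False
      using nc[of "{P, e2, e3}"] P ne by simp
  qed
  moreover have "P $ 2 \<noteq> 0"
  proof
    assume "P $ 2 = 0"
    then have "pg2_collinear {P, e1, e3}"
      unfolding pg2_collinear_def
      by (intro exI[of _ e2]) (simp add: vec3_eq_iff scalar_product_3)
    then show False
      using nc[of "{P, e1, e3}"] P ne by simp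
  qed
  moreover have "P $ 3 \<noteq> 0"
  proof
    assume "P $ 3 = 0"
    then have "pg2_collinear {P, e1, e2}"
      unfolding pg2_collinear_def
      by (intro exI[of _ e3]) (simp add: vec3_eq_iff scalar_product_3)
    then show False
      using nc[of "{P, e1, e2}"] P ne by simp
  qed
  ultimately show "P $ 1 = 1 \<and> P $ 2 \<noteq> 0 \<and> P $ 3 \<noteq> 0"
    using P(1) by (auto simp: pg2_def)
next
  fix P :: "'a ^ 3" assume "P \<in> {P. P $ 1 = 1 \<and> P $ 2 \<noteq> 0 \<and> P $ 3 \<noteq> 0}"
  then have P: "P $ 1 = 1" "P $ 2 \<noteq> 0" "P $ 3 \<noteq> 0"
    by auto
  let ?F = "{P, e1, e2, e3}"
  have ne: "P \<noteq> e1" "P \<noteq> e2" "P \<noteq> e3"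
    "(e1 :: 'a ^ 3) \<noteq> e2" "(e1 :: 'a ^ 3) \<noteq> e3" "(e2 :: 'a ^ 3) \<noteq> e3"
    using P by (auto simp: vec3_eq_iff)
  have "\<not> pg2_collinear S" if S: "S \<subseteq> ?F" "card S = 3" for S
  proof
    assume "pg2_collinear S"
    then obtain l where l: "l \<noteq> 0" "\<And>X. X \<in> S \<Longrightarrow> scalar_product l X = 0"
      by (auto simp: pg2_collinear_def)
    \<comment> \<open>\<open>S\<close> omits a single point \<open>z\<close>. If \<open>z\<close> is
      \<open>P\<close>, the base points kill every coefficient of \<open>l\<close>; otherwise two
      coefficients vanish and the equation at \<open>P\<close> kills the third.\<close>
    have "card (?F - S) = 1"
      using S ne by (subst card_Diff_subset) (auto intro: finite_subset)
    then obtain z where z: "?F - S = {z}"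
      by (auto simp: card_1_singleton_iff)
    then have "z \<in> ?F" and on: "\<And>X. X \<in> ?F \<Longrightarrow> X \<noteq> z \<Longrightarrow> scalar_product l X = 0"
      using l(2) by blast+
    have "P \<noteq> z \<Longrightarrow> l $ 1 + l $ 2 * P $ 2 + l $ 3 * P $ 3 = 0"
      "e1 \<noteq> z \<Longrightarrow> l $ 1 = 0" "e2 \<noteq> z \<Longrightarrow> l $ 2 = 0" "e3 \<noteq> z \<Longrightarrow> l $ 3 = 0"
      using on[of P] on[of e1] on[of e2] on[of e3] P by (simp_all add: scalar_product_3)
    then have "l $ 1 = 0 \<and> l $ 2 = 0 \<and> l $ 3 = 0"
      using \<open>z \<in> ?F\<close> ne P by auto
    then show False
      using l(1) by (simp add: vec3_eq_iff)
  qed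
  then show "P \<in> P1"
    using P ne by (simp add: P1_def pg2_def)
qed

lemma P1_eq_image: "P1 = cremona_point ` torus"
proof (intro equalityI subsetI)
  fix P :: "'a ^ 3" assume "P \<in> P1"
  then have "P = cremona_point (inverse (P $ 2), inverse (P $ 3))"
    "(inverse (P $ 2), inverse (P $ 3)) \<in> torus"
    by (auto simp: P1_eq cremona_point_def vec3_eq_iff torus_def)
  then show "P \<in> cremona_point ` torus"
    by blast
qed (auto simp: P1_eq cremona_point_def torus_def)

lemma inj_cremona_point: "inj_on cremona_point S"
  by (auto simp: inj_on_def cremona_point_def vec3_eq_iff)

lemma symmetric_entry: "transpose M = M \<Longrightarrow> M $ i $ j = M $ j $ i"
  using transpose_def[of M] by (metis vec_lambda_beta)

lemma scalar_product_symmetric_matrix: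
  fixes M :: "'a::field ^ 3 ^ 3"
  assumes "transpose M = M"
  shows "scalar_product (X v* M) X =
    M $ 1 $ 1 * (X $ 1)\<^sup>2 + M $ 2 $ 2 * (X $ 2)\<^sup>2 + M $ 3 $ 3 * (X $ 3)\<^sup>2 +
    2 * (M $ 1 $ 2 * X $ 1 * X $ 2 + M $ 1 $ 3 * X $ 1 * X $ 3 + M $ 2 $ 3 * X $ 2 * X $ 3)"
proof -
  have "M $ 2 $ 1 = M $ 1 $ 2" "M $ 3 $ 1 = M $ 1 $ 3" "M $ 3 $ 2 = M $ 2 $ 3"
    using symmetric_entry[OF assms] by blast+
  then show ?thesis
    by (simp add: scalar_product_3 vector_matrix_mult_def sum_3 power2_eq_square algebra_simps)
qed

text \<open>Only the mixed terms of the quadratic form survive. Dividing by 2 and multiplying by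
  \<open>u * v\<close> makes it linear; this swaps the roles of \<open>M $ 1 $ 2\<close> and
  \<open>M $ 1 $ 3\<close>, and dividing by \<open>- M $ 2 $ 3\<close> normalizes the
  constant.\<close>

lemma conic_of_inter_P1:
  fixes M :: "'a::field ^ 3 ^ 3"
  assumes two: "(2 :: 'a) \<noteq> 0" and sym: "transpose M = M"
    and diag: "M $ 1 $ 1 = 0" "M $ 2 $ 2 = 0" "M $ 3 $ 3 = 0" and nz: "M $ 2 $ 3 \<noteq> 0"
  shows "conic_of M \<inter> P1 = cremona_point ` line (- M $ 1 $ 3 / M $ 2 $ 3, - M $ 1 $ 2 / M $ 2 $ 3)"
proof -
  let ?a = "M $ 1 $ 2" and ?b = "M $ 1 $ 3" and ?c = "M $ 2 $ 3"
  have "cremona_point x \<in> conic_of M \<longleftrightarrow> x \<in> line (- ?b / ?c, - ?a / ?c)" if x: "x \<in> torus" for x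
  proof -
    obtain u v where [simp]: "x = (u, v)"
      by (metis surj_pair)
    have uv: "u \<noteq> 0" "v \<noteq> 0"
      using x by (auto simp: torus_def)
    have "scalar_product (cremona_point x v* M) (cremona_point x) =
        2 * (?a * inverse u + ?b * inverse v + ?c * inverse u * inverse v)"
      by (simp add: scalar_product_symmetric_matrix[OF sym] diag cremona_point_def)
    then have "cremona_point x \<in> conic_of M \<longleftrightarrow> ?a * inverse u + ?b * inverse v + ?c * inverse u * inverse v = 0"
      using two by (simp add: conic_of_def pg2_def cremona_point_def del: distrib_left_numeral)
    also have "\<dots> \<longleftrightarrow> ?a * v + ?b * u + ?c = 0"
      using uv by (simp add: field_simps)
    also have "\<dots> \<longleftrightarrow> - (?a * v + ?b * u) / ?c = 1"
      using nz by (simp only: divide_eq_eq neg_eq_iff_add_eq_0) simp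
    also have "- (?a * v + ?b * u) / ?c = - ?b / ?c * u + - ?a / ?c * v"
      using nz by (simp add: field_simps)
    finally show ?thesis
      using x by (simp add: line_def)
  qed
  then show ?thesis
    using line_subset_torus by (fastforce simp: P1_eq_image)
qed

text \<open>Passing through the base points means a zero diagonal. The determinant is then twice the
  product of the off-diagonal entries, so nonsingularity matches both line coefficients being
  nonzero.\<close>

lemma C1_blocks_eq_image:
  assumes two: "(2 :: 'a::field) \<noteq> 0"
  shows "(C1_blocks :: ('a ^ 3) set set) = (`) cremona_point ` line ` torus"
proof (intro equalityI subsetI)
  fix B :: "('a ^ 3) set" assume "B \<in> C1_blocks"
  then obtain M where B: "B = conic_of M \<inter> P1" and sym: "transpose M = M" and det: "det M \<noteq> 0"
    and e: "e1 \<in> conic_of M" "e2 \<in> conic_of M" "e3 \<in> conic_of M"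
    by (auto simp: C1_blocks_def C1_def conics_def)
  have diag: "M $ 1 $ 1 = 0" "M $ 2 $ 2 = 0" "M $ 3 $ 3 = 0"
    using e by (auto simp: conic_of_def scalar_product_symmetric_matrix[OF sym])
  have "M $ 2 $ 1 = M $ 1 $ 2" "M $ 3 $ 1 = M $ 1 $ 3" "M $ 3 $ 2 = M $ 2 $ 3"
    using symmetric_entry[OF sym] by blast+
  then have "det M = 2 * (M $ 1 $ 2 * M $ 1 $ 3 * M $ 2 $ 3)"
    by (simp add: det_3 diag algebra_simps)
  then have nz: "M $ 1 $ 2 \<noteq> 0" "M $ 1 $ 3 \<noteq> 0" "M $ 2 $ 3 \<noteq> 0"
    using det by auto
  then show "B \<in> (`) cremona_point ` line ` torus"
    unfolding B conic_of_inter_P1[OF two sym diag nz(3)]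
    by (intro imageI) (simp add: torus_def)
next
  fix B :: "('a ^ 3) set" assume "B \<in> (`) cremona_point ` line ` torus"
  then obtain a b where B: "B = cremona_point ` line (a, b)" and ab: "a \<noteq> 0" "b \<noteq> 0"
    by (auto simp: torus_def)
  \<comment> \<open>The entries solve \<open>- M $ 1 $ 3 = a\<close> and
    \<open>- M $ 1 $ 2 = b\<close> under the scaling \<open>M $ 2 $ 3 = 1\<close>.\<close>
  define M :: "'a ^ 3 ^ 3" where
    "M = vector [vector [0, - b, - a], vector [- b, 0, 1], vector [- a, 1, 0]]"
  have sym: "transpose M = M"
    by (simp add: vec3_eq_iff transpose_def M_def)
  have "det M = 2 * (a * b)"
    by (simp add: det_3 M_def)
  then have "det M \<noteq> 0"
    using two ab by simp
  moreover have "e1 \<in> conic_of M" "e2 \<in> conic_of M" "e3 \<in> conic_of M"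
    by (simp_all add: conic_of_def pg2_def scalar_product_symmetric_matrix[OF sym]) (simp_all add: M_def)
  moreover have "B = conic_of M \<inter> P1"
    unfolding B by (subst conic_of_inter_P1[OF two sym]) (simp_all add: M_def)
  ultimately show "B \<in> C1_blocks"
    using sym by (auto simp: C1_blocks_def C1_def conics_def)
qed

text \<open>The characteristic divides the order of the field, so it cannot be 2.\<close>

lemma two_neq_zero_if_odd_card:
  assumes "odd CARD('a::{field,finite})"
  shows "(2 :: 'a) \<noteq> 0"
proof
  assume "(2 :: 'a) = 0"
  then have "CHAR('a) dvd 2"
    using of_nat_eq_0_iff_char_dvd[where 'a = 'a, of 2] by simp
  then have "CHAR('a) = 2"
    using CHAR_not_1'[where 'a = 'a] using two_is_prime_nat by (metis One_nat_def prime_nat_iff)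
  then show False
    using CHAR_dvd_CARD[where 'a = 'a] assms by simp
qed

theorem theorem3p7:
  fixes q :: nat
  assumes "q = CARD('a::{field,finite})"
    and "primepow q" and "odd q" and "q \<ge> 5"
  shows "generalized_partial_geometry 3 (P1 :: ('a ^ 3) set) C1_blocks
           (q - 3) (q - 3) {q - 5, q - 4, q - 3}"
proof -
  have two: "(2 :: 'a) \<noteq> 0"
    using assms two_neq_zero_if_odd_card by blast
  show ?thesis
    unfolding P1_eq_image C1_blocks_eq_image[OF two] assms(1)
    using generalized_partial_geometry_image[OF inj_cremona_point]
      generalized_partial_geometry_lines[OF two] assms(1,4) by blast
qed

end
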